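(* Let $\rho$ and $\sigma$ be two states on $\mathcal{H}_{[n]}=\bigotimes_{i=1}^n\mathcal{H}_i$, and let $T\subseteq[n]$. In the $n$-qubit parallelized SWAP test of $\rho$ and $\sigma$, we have $$\mathrm{Tr}(\rho_T\sigma_T)=\sum_{\mathbf{z}\in\mathbb{Z}_2^n}(-1)^{\mathbf{z}\cdot\mathbf{t}}\,p(\mathbf{z}),$$ where $\mathbf{t}\in\mathbb{Z}_2^n$ is the vector with $\mathrm{supp}(\mathbf{t})=T$.
   Context: $[n]=\{1,\dots,n\}$. $\mathcal{H}_1,\dots,\mathcal{H}_n$ are finite-dimensional complex Hilbert spaces (for this result the local dimensions are arbitrary and need not be equal), and $\mathcal{H}_{[n]}=\bigotimes_{i=1}^n\mathcal{H}_i$. A state on $\mathcal{H}_{[n]}$ is a positive semidefinite operator of trace $1$. For $S\subseteq[n]$, $S^c=[n]\setminus S$ and $\rho_S=\mathrm{Tr}_{S^c}\rho$ is the reduced state (partial trace over the factors in $S^c$); for $S=\emptyset$, $\mathrm{Tr}(\rho_\emptyset\sigma_\emptyset)=1$. For $\mathbf{z}=(z_1,\dots,z_n)\in\mathbb{Z}_2^n$, $\mathrm{supp}(\mathbf{z})=\{i: z_i\neq 0\}$; for $\mathbf{u},\mathbf{v}\in\mathbb{Z}_2^n$, $\mathbf{u}\cdot\mathbf{v}=\sum_i u_iv_i=|\mathrm{supp}(\mathbf{u})\cap\mathrm{supp}(\mathbf{v})|$. The $n$-qubit parallelized SWAP test of $\rho$ and $\sigma$ is the following circuit. There are $n$ ancilla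 qubits $A_1,\dots,A_n$, and registers $B_1,\dots,B_n$ and $C_1,\dots,C_n$ with $B_i\cong C_i\cong\mathcal{H}_i$. The initial state is $(|0\rangle\langle 0|)^{\otimes n}\otimes\rho\otimes\sigma$, with $\rho$ on $B_1\cdots B_n$ and $\sigma$ on $C_1\cdots C_n$. Apply a Hadamard gate $H$ to each ancilla $A_i$; then for each $i$ apply the controlled-SWAP gate with control $A_i$ which swaps $B_i$ and $C_i$ when $A_i$ is in state $|1\rangle$ (and acts trivially when $A_i$ is in state $|0\rangle$); then apply $H$ to each ancilla again; finally measure all ancillas in the computational basis. $p(\mathbf{z})$ denotes the probability of obtaining outcome $\mathbf{z}\in\mathbb{Z}_2^n$. *)

theory Defs
  imports Complex_Main "HOL-Library.FuncSet"
begin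

(* A composite system is a finite set R of register labels together with local dimensions d;
   register r carries the Hilbert space C^(d r).  The computational product basis of the tensor
   product over R consists of the extensional functions choosing, for each r in R, an index below
   d r.  An operator is given by its matrix entries in this basis; entries outside the basis are
   never inspected. *)

definition basis :: "'r set \<Rightarrow> ('r \<Rightarrow> nat) \<Rightarrow> ('r \<Rightarrow> nat) set" where
  "basis R d = (\<Pi>\<^sub>E r\<in>R. {..<d r})"

type_synonym 'r operator = "('r \<Rightarrow> nat) \<Rightarrow> ('r \<Rightarrow> nat) \<Rightarrow> complex"

definition op_mult :: "'r set \<Rightarrow> ('r \<Rightarrow> nat) \<Rightarrow> 'r operator \<Rightarrow> 'r operator \<Rightarrow> 'r operator" where
  "op_mult R d M N = (\<lambda>x y. \<Sum>w\<in>basis R d. M x w * N w y)"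

definition op_adjoint :: "'r operator \<Rightarrow> 'r operator" where
  "op_adjoint M = (\<lambda>x y. cnj (M y x))"

definition op_trace :: "'r set \<Rightarrow> ('r \<Rightarrow> nat) \<Rightarrow> 'r operator \<Rightarrow> complex" where
  "op_trace R d M = (\<Sum>x\<in>basis R d. M x x)"

definition pos_semidef :: "'r set \<Rightarrow> ('r \<Rightarrow> nat) \<Rightarrow> 'r operator \<Rightarrow> bool" where
  "pos_semidef R d M \<longleftrightarrow>
     (\<forall>v :: ('r \<Rightarrow> nat) \<Rightarrow> complex.
        let q = (\<Sum>x\<in>basis R d. \<Sum>y\<in>basis R d. cnj (v x) * M x y * v y)
        in Im q = 0 \<and> 0 \<le> Re q)"

definition state :: "'r set \<Rightarrow> ('r \<Rightarrow> nat) \<Rightarrow> 'r operator \<Rightarrow> bool" where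
  "state R d M \<longleftrightarrow> pos_semidef R d M \<and> op_trace R d M = 1"

(* Partial trace over the registers in R - S.  The basis vector override_on w x S takes its S-part
   from x and its (R - S)-part from w. *)
definition reduced :: "'r set \<Rightarrow> ('r \<Rightarrow> nat) \<Rightarrow> 'r set \<Rightarrow> 'r operator \<Rightarrow> 'r operator" where
  "reduced R d S M = (\<lambda>x y. \<Sum>w\<in>basis (R - S) d. M (override_on w x S) (override_on w y S))"

(* The operator acting as M on the registers in S and as the identity on those in R - S. *)
definition op_on :: "'r set \<Rightarrow> 'r set \<Rightarrow> 'r operator \<Rightarrow> 'r operator" where
  "op_on R S M = (\<lambda>x y. if \<forall>r\<in>R - S. x r = y r then M (restrict x S) (restrict y S) else 0)"

definition apply_gate :: "'r set \<Rightarrow> ('r \<Rightarrow> nat) \<Rightarrow> 'r operator \<Rightarrow> 'r operator \<Rightarrow> 'r operator" where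
  "apply_gate R d U M = op_mult R d (op_mult R d U M) (op_adjoint U)"


abbreviation bit_vectors :: "nat \<Rightarrow> (nat \<Rightarrow> nat) set" where
  "bit_vectors n \<equiv> basis {1..n} (\<lambda>_. 2)"

definition supp :: "nat \<Rightarrow> (nat \<Rightarrow> nat) \<Rightarrow> nat set" where
  "supp n z = {i\<in>{1..n}. z i \<noteq> 0}"

definition bit_dot :: "nat \<Rightarrow> (nat \<Rightarrow> nat) \<Rightarrow> (nat \<Rightarrow> nat) \<Rightarrow> nat" where
  "bit_dot n u v = (\<Sum>i\<in>{1..n}. u i * v i)"


datatype reg = A nat | B nat | C nat

definition regs :: "nat \<Rightarrow> reg set" where
  "regs n = A ` {1..n} \<union> B ` {1..n} \<union> C ` {1..n}"

fun reg_dim :: "(nat \<Rightarrow> nat) \<Rightarrow> reg \<Rightarrow> nat" where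
  "reg_dim d (A i) = 2"
| "reg_dim d (B i) = d i"
| "reg_dim d (C i) = d i"

definition hadamard :: "reg \<Rightarrow> reg operator" where
  "hadamard r = (\<lambda>x y. (- 1) ^ (x r * y r) / of_real (sqrt 2))"

definition cswap_basis :: "nat \<Rightarrow> (reg \<Rightarrow> nat) \<Rightarrow> (reg \<Rightarrow> nat)" where
  "cswap_basis i y = (if y (A i) = 1 then y(B i := y (C i), C i := y (B i)) else y)"

definition cswap :: "nat \<Rightarrow> reg operator" where
  "cswap i = (\<lambda>x y. if x = cswap_basis i y then 1 else 0)"

definition hadamard_layer :: "nat \<Rightarrow> reg operator list" where
  "hadamard_layer n = map (\<lambda>i. op_on (regs n) {A i} (hadamard (A i))) [1..<Suc n]"

definition cswap_layer :: "nat \<Rightarrow> reg operator list" where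
  "cswap_layer n = map (\<lambda>i. op_on (regs n) {A i, B i, C i} (cswap i)) [1..<Suc n]"

definition swap_test_input :: "nat \<Rightarrow> nat operator \<Rightarrow> nat operator \<Rightarrow> reg operator" where
  "swap_test_input n \<rho> \<sigma> = (\<lambda>x y.
     (\<Prod>i\<in>{1..n}. if x (A i) = 0 \<and> y (A i) = 0 then 1 else 0)
     * \<rho> (\<lambda>i\<in>{1..n}. x (B i)) (\<lambda>i\<in>{1..n}. y (B i))
     * \<sigma> (\<lambda>i\<in>{1..n}. x (C i)) (\<lambda>i\<in>{1..n}. y (C i)))"

definition swap_test_output ::
    "nat \<Rightarrow> (nat \<Rightarrow> nat) \<Rightarrow> nat operator \<Rightarrow> nat operator \<Rightarrow> reg operator" where
  "swap_test_output n d \<rho> \<sigma> =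
     fold (apply_gate (regs n) (reg_dim d))
       (hadamard_layer n @ cswap_layer n @ hadamard_layer n)
       (swap_test_input n \<rho> \<sigma>)"

(* |z><z| on the ancillas *)
definition ancilla_proj :: "nat \<Rightarrow> (nat \<Rightarrow> nat) \<Rightarrow> reg operator" where
  "ancilla_proj n z = (\<lambda>x y. if \<forall>i\<in>{1..n}. x (A i) = z i \<and> y (A i) = z i then 1 else 0)"

(* Born rule for the outcome z; the trace is real when the input operators are states. *)
definition swap_test_prob ::
    "nat \<Rightarrow> (nat \<Rightarrow> nat) \<Rightarrow> nat operator \<Rightarrow> nat operator \<Rightarrow> (nat \<Rightarrow> nat) \<Rightarrow> real" where
  "swap_test_prob n d \<rho> \<sigma> z =
     Re (op_trace (regs n) (reg_dim d)
       (op_mult (regs n) (reg_dim d)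
         (op_on (regs n) (A ` {1..n}) (ancilla_proj n z))
         (swap_test_output n d \<rho> \<sigma>)))"

end

theory Submission
  imports Defs
begin

text \<open>
  Weighting outcome z with (-1)^(z . t) turns the ancilla measurement into the observable that acts
  as Pauli Z on the ancillas in T. Conjugation by the last Hadamard layer turns it into Pauli X on
  these ancillas. The ancillas enter the controlled swaps in the uniform superposition, and
  comparing the two sides of a matrix entry whose ancilla bits differ exactly on T leaves, after a
  relabelling of the basis, just the swap of B and C on the factors in T. Its expectation is the
  overlap of the reduced states.
\<close>

subsection \<open>Operators and gates in the product basis\<close>

lemma finite_basis [simp]: "finite R \<Longrightarrow> finite (basis R d)"
  unfolding basis_def by (intro finite_PiE) auto

lemma basis_eqI:
  assumes "x \<in> basis R d" "y \<in> basis R d" "\<And>r. r \<in> R \<Longrightarrow> x r = y r"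
  shows "x = y"
  using assms unfolding basis_def by (meson PiE_ext)

text \<open>Polarisation: a sesquilinear form whose quadratic form is real everywhere is Hermitian,
  as seen on vectors supported on at most two basis elements.\<close>

lemma pos_semidef_hermitian:
  assumes "finite R" "pos_semidef R d M" "x \<in> basis R d" "y \<in> basis R d"
  shows "cnj (M x y) = M y x"
proof -
  have real_form:
    "Im (\<Sum>x\<in>basis R d. \<Sum>y\<in>basis R d. cnj (v x) * M x y * v y) = 0" for v
    using assms(2) unfolding pos_semidef_def Let_def by blast
  \<comment> \<open>Cuts the form down to the support \<open>Y\<close> of the test vector, so that
    one- and two-point vectors give explicit expressions.\<close>
  have supported:
    "(\<Sum>a\<in>basis R d. \<Sum>b\<in>basis R d. cnj (v a) * M a b * v b)
       = (\<Sum>a\<in>Y. \<Sum>b\<in>Y. cnj (v a) * M a b * v b)"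
    if "Y \<subseteq> basis R d" "\<And>a. a \<notin> Y \<Longrightarrow> v a = 0" for v Y
  proof -
    have "(\<Sum>b\<in>basis R d. cnj (v a) * M a b * v b) = (\<Sum>b\<in>Y. cnj (v a) * M a b * v b)" for a
      using that assms(1) by (intro sum.mono_neutral_right) auto
    then show ?thesis
      using that assms(1) by (simp, intro sum.mono_neutral_right) auto
  qed
  have supported_real: "Im (\<Sum>a\<in>Y. \<Sum>b\<in>Y. cnj (v a) * M a b * v b) = 0"
    if "Y \<subseteq> basis R d" "\<And>a. a \<notin> Y \<Longrightarrow> v a = 0" for v Y
    using real_form[of v] supported[where v = v and Y = Y, OF that] by simp
  have diag: "Im (M a a) = 0" if "a \<in> basis R d" for a
    using supported_real[of "{a}" "\<lambda>b. if b = a then 1 else 0"] that by simp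
  show ?thesis
  proof (cases "x = y")
    case True
    then show ?thesis using diag[OF assms(3)] by (simp add: complex_eq_iff)
  next
    case False
    have "Im (M x x + M x y * c + cnj c * M y x + cnj c * M y y * c) = 0" for c
      using supported_real[of "{x, y}" "\<lambda>b. if b = x then 1 else if b = y then c else 0"]
        assms False
      by (simp add: algebra_simps)
    \<comment> \<open>With real diagonal entries, \<open>c = 1\<close> makes the imaginary parts of
      \<open>M x y\<close> and \<open>M y x\<close> opposite, and \<open>c = \<i>\<close> makes
      their real parts equal.\<close>
    from this[of 1] this[of \<i>] show ?thesis
      using diag assms by (simp add: complex_eq_iff)
  qed
qed

lemma apply_gate_entry:
  "apply_gate R d U N x y =
     (\<Sum>w\<in>basis R d. (\<Sum>v\<in>basis R d. U x v * N v w) * cnj (U y w))"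
  by (simp add: apply_gate_def op_mult_def op_adjoint_def)

lemma apply_gate_cong:
  assumes "\<And>x y. x \<in> basis R d \<Longrightarrow> y \<in> basis R d \<Longrightarrow> N x y = N' x y"
  shows "apply_gate R d U N = apply_gate R d U N'"
  using assms by (auto simp: apply_gate_entry fun_eq_iff intro!: sum.cong)

text \<open>Closed forms of intermediate operators hold only on basis entries. A gate inspects no
  other entries, so after the first gate the two operators coincide as functions.\<close>

lemma fold_apply_gate_cong:
  assumes "\<And>x y. x \<in> basis R d \<Longrightarrow> y \<in> basis R d \<Longrightarrow> N x y = N' x y"
    and "x \<in> basis R d" "y \<in> basis R d"
  shows "fold (apply_gate R d) Us N x y = fold (apply_gate R d) Us N' x y"
proof (cases Us)
  case Nil
  then show ?thesis using assms by simp
next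
  case (Cons U Vs)
  have "apply_gate R d U N = apply_gate R d U N'"
    by (rule apply_gate_cong) (rule assms(1))
  then show ?thesis using Cons by simp
qed

lemma finite_regs [simp]: "finite (regs n)"
  by (simp add: regs_def)

lemma in_regs [simp]:
  "A i \<in> regs n \<longleftrightarrow> i \<in> {1..n}" "B i \<in> regs n \<longleftrightarrow> i \<in> {1..n}" "C i \<in> regs n \<longleftrightarrow> i \<in> {1..n}"
  by (auto simp: regs_def)

abbreviation reg_basis :: "nat \<Rightarrow> (nat \<Rightarrow> nat) \<Rightarrow> (reg \<Rightarrow> nat) set" where
  "reg_basis n d \<equiv> basis (regs n) (reg_dim d)"

lemma in_reg_basis:
  "x \<in> reg_basis n d \<longleftrightarrow>
     (\<forall>i\<in>{1..n}. x (A i) < 2 \<and> x (B i) < d i \<and> x (C i) < d i) \<and>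
     (\<forall>i. i \<notin> {1..n} \<longrightarrow> x (A i) = undefined \<and> x (B i) = undefined \<and> x (C i) = undefined)"
  (is "_ \<longleftrightarrow> ?rhs")
proof
  assume "x \<in> reg_basis n d"
  then have "\<And>r. r \<in> regs n \<Longrightarrow> x r < reg_dim d r" "\<And>r. r \<notin> regs n \<Longrightarrow> x r = undefined"
    by (auto simp: basis_def PiE_iff extensional_def)
  from this(1)[of "A _"] this(1)[of "B _"] this(1)[of "C _"]
    this(2)[of "A _"] this(2)[of "B _"] this(2)[of "C _"]
  show ?rhs by simp
next
  assume *: ?rhs
  have "x r < reg_dim d r" if "r \<in> regs n" for r
    using * that by (cases r) auto
  moreover have "x r = undefined" if "r \<notin> regs n" for r
    using * that by (cases r) auto
  ultimately show "x \<in> reg_basis n d"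
    by (auto simp: basis_def PiE_iff extensional_def)
qed

lemma reg_fun_eqI:
  assumes "\<And>i. x (A i) = y (A i)" "\<And>i. x (B i) = y (B i)" "\<And>i. x (C i) = y (C i)"
  shows "x = y"
proof
  fix r show "x r = y r" using assms by (cases r) auto
qed

lemma ancilla_update_in_basis:
  assumes "x \<in> reg_basis n d" "i \<in> {1..n}" "s < 2"
  shows "x(A i := s) \<in> reg_basis n d"
  using assms by (auto simp: in_reg_basis)

subsection \<open>Hadamard gates\<close>

abbreviation hadamard_gate :: "nat \<Rightarrow> nat \<Rightarrow> reg operator" where
  "hadamard_gate n i \<equiv> op_on (regs n) {A i} (hadamard (A i))"

lemma cnj_hadamard_gate: "cnj (hadamard_gate n i x y) = hadamard_gate n i x y"
  by (simp add: op_on_def hadamard_def)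

text \<open>Row \<open>x\<close> of the gate vanishes except at the two vectors that agree with
  \<open>x\<close> away from \<open>A i\<close>.\<close>

lemma hadamard_gate_sum:
  assumes "x \<in> reg_basis n d" "i \<in> {1..n}"
  shows "(\<Sum>v\<in>reg_basis n d. hadamard_gate n i x v * f v) =
    (f (x(A i := 0)) + (- 1) ^ x (A i) * f (x(A i := 1))) / of_real (sqrt 2)"
proof -
  let ?Y = "{x(A i := 0), x(A i := 1)}"
  have "hadamard_gate n i x v = 0" if "v \<in> reg_basis n d - ?Y" for v
  proof -
    have "\<not> (\<forall>r\<in>regs n - {A i}. x r = v r)"
    proof
      assume *: "\<forall>r\<in>regs n - {A i}. x r = v r"
      have vi: "v (A i) < 2" using that assms by (auto simp: in_reg_basis)
      then have "v = x(A i := v (A i))"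
        using * that assms by (intro basis_eqI[OF _ ancilla_update_in_basis]) auto
      moreover have "v (A i) = 0 \<or> v (A i) = 1" using vi by auto
      ultimately show False using that by auto
    qed
    then show ?thesis unfolding op_on_def by (rule if_not_P)
  qed
  then have "(\<Sum>v\<in>reg_basis n d. hadamard_gate n i x v * f v)
      = (\<Sum>v\<in>?Y. hadamard_gate n i x v * f v)"
    using ancilla_update_in_basis[OF assms]
    by (intro sum.mono_neutral_right) auto
  also have "x(A i := 0) \<noteq> x(A i := 1)"
    by (metis fun_upd_same zero_neq_one)
  then have "(\<Sum>v\<in>?Y. hadamard_gate n i x v * f v) =
    hadamard_gate n i x (x(A i := 0)) * f (x(A i := 0)) +
    hadamard_gate n i x (x(A i := 1)) * f (x(A i := 1))"
    by simp
  also have "\<dots> = (f (x(A i := 0)) + (- 1) ^ x (A i) * f (x(A i := 1))) / of_real (sqrt 2)"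
    by (simp add: op_on_def hadamard_def field_simps)
  finally show ?thesis .
qed

lemma apply_hadamard_gate:
  assumes "x \<in> reg_basis n d" "y \<in> reg_basis n d" "i \<in> {1..n}"
  shows "apply_gate (regs n) (reg_dim d) (hadamard_gate n i) N x y =
    (N (x(A i := 0)) (y(A i := 0)) + (- 1) ^ x (A i) * N (x(A i := 1)) (y(A i := 0))
     + (- 1) ^ y (A i) * N (x(A i := 0)) (y(A i := 1))
     + (- 1) ^ (x (A i) + y (A i)) * N (x(A i := 1)) (y(A i := 1))) / 2"
proof -
  have sqrt2: "complex_of_real (sqrt 2) * complex_of_real (sqrt 2) = 2"
    by (metis abs_numeral of_real_mult of_real_numeral real_sqrt_mult_self)
  \<comment> \<open>The gate is real, so multiplication by its adjoint on the right is again a row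
    sum, now for row \<open>y\<close>.\<close>
  have "apply_gate (regs n) (reg_dim d) (hadamard_gate n i) N x y =
      (\<Sum>w\<in>reg_basis n d. hadamard_gate n i y w *
        (\<Sum>v\<in>reg_basis n d. hadamard_gate n i x v * N v w))"
    by (simp only: apply_gate_entry cnj_hadamard_gate mult.commute)
  also have "\<dots> =
    ((N (x(A i := 0)) (y(A i := 0)) + (- 1) ^ x (A i) * N (x(A i := 1)) (y(A i := 0)))
        / of_real (sqrt 2)
     + (- 1) ^ y (A i) * ((N (x(A i := 0)) (y(A i := 1))
        + (- 1) ^ x (A i) * N (x(A i := 1)) (y(A i := 1))) / of_real (sqrt 2))) / of_real (sqrt 2)"
    by (simp only: hadamard_gate_sum[OF assms(1,3)] hadamard_gate_sum[OF assms(2,3)])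
  also have "\<dots> =
    (N (x(A i := 0)) (y(A i := 0)) + (- 1) ^ x (A i) * N (x(A i := 1)) (y(A i := 0))
     + (- 1) ^ y (A i) * (N (x(A i := 0)) (y(A i := 1))
     + (- 1) ^ x (A i) * N (x(A i := 1)) (y(A i := 1)))) / (of_real (sqrt 2) * of_real (sqrt 2))"
    by (simp add: add_divide_distrib distrib_left)
  finally show ?thesis
    unfolding sqrt2 by (simp add: power_add algebra_simps)
qed

text \<open>Each gate turns the factor \<open>|0><0|\<close> of its ancilla into the matrix with all
  entries 1/2. The part \<open>g\<close> does not see these ancillas; it is left arbitrary so that
  the induction can absorb the halves into it.\<close>

lemma hadamard_layer_on_zeros:
  assumes "distinct is" "set is \<subseteq> {1..n}"
    and "\<And>x y i s. i \<in> set is \<Longrightarrow> g (x(A i := s)) y = g x y"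
    and "\<And>x y i s. i \<in> set is \<Longrightarrow> g x (y(A i := s)) = g x y"
    and "x \<in> reg_basis n d" "y \<in> reg_basis n d"
  shows "fold (apply_gate (regs n) (reg_dim d)) (map (hadamard_gate n) is)
      (\<lambda>x y. (\<Prod>i\<in>set is. if x (A i) = 0 \<and> y (A i) = 0 then 1 else 0) * g x y) x y
    = g x y / 2 ^ length is"
  using assms
proof (induction "is" arbitrary: g)
  case Nil
  then show ?case by simp
next
  case (Cons i js)
  let ?P = "\<lambda>js x y. \<Prod>i\<in>set js. if x (A i) = 0 \<and> y (A i) = (0::nat) then 1 else 0 :: complex"
  \<comment> \<open>Of the four terms of the gate formula, only the one with both bits 0 survives
    the factor for \<open>i\<close>.\<close>
  have gate: "apply_gate (regs n) (reg_dim d) (hadamard_gate n i)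
      (\<lambda>x y. ?P (i # js) x y * g x y) u v = ?P js u v * (g u v / 2)"
    if "u \<in> reg_basis n d" "v \<in> reg_basis n d" for u v
  proof -
    have upd: "?P js (u(A i := a)) (v(A i := b)) = ?P js u v" for a b
      using Cons.prems(1) by (intro prod.cong) auto
    show ?thesis
      using Cons.prems that
      by (simp add: apply_hadamard_gate upd del: fun_upd_apply) (simp add: upd)
  qed
  have "fold (apply_gate (regs n) (reg_dim d)) (map (hadamard_gate n) js)
      (\<lambda>x y. ?P js x y * (g x y / 2)) x y = g x y / 2 / 2 ^ length js"
    using Cons.prems by (intro Cons.IH) auto
  moreover have "fold (apply_gate (regs n) (reg_dim d)) (map (hadamard_gate n) (i # js))
      (\<lambda>x y. ?P (i # js) x y * g x y) x y =
    fold (apply_gate (regs n) (reg_dim d)) (map (hadamard_gate n) js)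
      (\<lambda>x y. ?P js x y * (g x y / 2)) x y"
    using fold_apply_gate_cong[OF gate Cons.prems(5,6)] by simp
  ultimately show ?case by simp
qed

text \<open>The action of Pauli X on basis vectors, for the ancillas in \<open>S\<close>. The
  truncated \<open>1 - x (A i)\<close> is the complement because ancilla entries of basis vectors
  are 0 or 1.\<close>

definition flip_ancillas :: "nat set \<Rightarrow> (reg \<Rightarrow> nat) \<Rightarrow> reg \<Rightarrow> nat" where
  "flip_ancillas S x = (\<lambda>r. case r of A i \<Rightarrow> if i \<in> S then 1 - x (A i) else x (A i) | _ \<Rightarrow> x r)"

lemma flip_ancillas_simps [simp]:
  "flip_ancillas S x (A i) = (if i \<in> S then 1 - x (A i) else x (A i))"
  "flip_ancillas S x (B i) = x (B i)"
  "flip_ancillas S x (C i) = x (C i)"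
  by (simp_all add: flip_ancillas_def)

lemma flip_ancillas_in_basis:
  "x \<in> reg_basis n d \<Longrightarrow> S \<subseteq> {1..n} \<Longrightarrow> flip_ancillas S x \<in> reg_basis n d"
  by (auto simp: in_reg_basis)

text \<open>
  The (unnormalised) expectation in N of Pauli Z on the ancillas in T \<inter> K and Pauli X on those
  in T - K. Each Hadamard gate turns one Z into an X.
\<close>

definition pauli_expectation ::
    "nat \<Rightarrow> (nat \<Rightarrow> nat) \<Rightarrow> nat set \<Rightarrow> nat set \<Rightarrow> reg operator \<Rightarrow> complex" where
  "pauli_expectation n d T K N =
     (\<Sum>x\<in>reg_basis n d. (\<Prod>i\<in>T \<inter> K. (- 1) ^ x (A i)) * N x (flip_ancillas (T - K) x))"

text \<open>Flipping one ancilla bit permutes the basis, so \<open>f\<close> may be averaged with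
  its flipped version. Keeping the full basis as index set lets two such sums be compared summand by
  summand.\<close>

lemma sum_split_ancilla:
  fixes f :: "(reg \<Rightarrow> nat) \<Rightarrow> complex"
  assumes "i \<in> {1..n}"
  shows "(\<Sum>x\<in>reg_basis n d. f x) = (\<Sum>x\<in>reg_basis n d. (f (x(A i := 0)) + f (x(A i := 1))) / 2)"
proof -
  let ?h = "\<lambda>x. x(A i := 1 - x (A i))"
  have h: "?h (?h x) = x \<and> ?h x \<in> reg_basis n d" if x: "x \<in> reg_basis n d" for x
  proof -
    have "x (A i) < 2" using x assms by (auto simp: in_reg_basis)
    then have "x (A i) \<le> 1" by simp
    then show ?thesis using x assms by (auto intro!: ancilla_update_in_basis)
  qed
  have "(\<Sum>x\<in>reg_basis n d. f x) = (\<Sum>x\<in>reg_basis n d. f (?h x))"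
    by (rule sum.reindex_bij_witness[of _ ?h ?h]) (simp_all only: h)
  then have "(\<Sum>x\<in>reg_basis n d. f x) = (\<Sum>x\<in>reg_basis n d. (f x + f (?h x)) / 2)"
    by (simp add: sum.distrib add_divide_distrib flip: sum_divide_distrib)
  also have "\<dots> = (\<Sum>x\<in>reg_basis n d. (f (x(A i := 0)) + f (x(A i := 1))) / 2)"
  proof (intro sum.cong refl)
    fix x assume "x \<in> reg_basis n d"
    then have "x (A i) < 2" using assms by (auto simp: in_reg_basis)
    then consider "x (A i) = 0" | "x (A i) = 1" by linarith
    then show "(f x + f (?h x)) / 2 = (f (x(A i := 0)) + f (x(A i := 1))) / 2"
      by cases (metis add.commute diff_self_eq_0 diff_zero fun_upd_triv)+
  qed
  finally show ?thesis .
qed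

text \<open>Moving the gate from the operator to the observable uses HZH = X if \<open>i\<close> is
  in \<open>T\<close>, and HH = 1 otherwise.\<close>

lemma pauli_expectation_hadamard:
  assumes "T \<subseteq> {1..n}" "i \<in> {1..n}" "i \<in> K"
  shows "pauli_expectation n d T K (apply_gate (regs n) (reg_dim d) (hadamard_gate n i) N)
    = pauli_expectation n d T (K - {i}) N"
proof -
  have "finite T" using assms(1) finite_subset by blast
  let ?H = "apply_gate (regs n) (reg_dim d) (hadamard_gate n i) N"
  let ?F = "flip_ancillas (T - K)" and ?G = "flip_ancillas (T - (K - {i}))"
  let ?p = "\<lambda>K x. \<Prod>j\<in>T \<inter> K. (- 1) ^ x (A j) :: complex"
  let ?f = "\<lambda>x. ?p K x * ?H x (?F x)"
  let ?g = "\<lambda>x. ?p (K - {i}) x * N x (?G x)"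
  have split: "?f (x(A i := 0)) + ?f (x(A i := 1)) = ?g (x(A i := 0)) + ?g (x(A i := 1))"
    if x: "x \<in> reg_basis n d" for x
  proof -
    have basis: "x(A i := s) \<in> reg_basis n d" "?F (x(A i := s)) \<in> reg_basis n d"
      if "s < 2" for s
      using x assms that ancilla_update_in_basis flip_ancillas_in_basis
      by (auto intro!: ancilla_update_in_basis flip_ancillas_in_basis)
    have F: "(?F (x(A i := s)))(A i := s') = (?F x)(A i := s')" for s s'
      by (rule reg_fun_eqI) auto
    \<comment> \<open>Since \<open>i\<close> is in \<open>K\<close>, \<open>?F\<close> leaves bit
      \<open>i\<close> alone, whereas \<open>?G\<close> flips it exactly when \<open>i\<close> is in
      \<open>T\<close>.\<close>
    have G: "?G (x(A i := s)) = (?F x)(A i := if i \<in> T then 1 - s else s)" for s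
      using assms by (intro reg_fun_eqI) auto
    have p: "?p (K - {i}) (x(A i := s)) = ?p (K - {i}) x" for s
      by (intro prod.cong) auto
    have pK: "?p K (x(A i := s)) = (if i \<in> T then (- 1) ^ s else 1) * ?p (K - {i}) x" for s
    proof (cases "i \<in> T")
      case True
      then have "T \<inter> K = insert i (T \<inter> (K - {i}))" using assms by auto
      then show ?thesis using True \<open>finite T\<close> p by simp
    next
      case False
      then have "T \<inter> K = T \<inter> (K - {i})" by auto
      then show ?thesis using False p by simp
    qed
    \<comment> \<open>Both indices carry the same bit \<open>s\<close> at \<open>i\<close>, so the
      sign of the last term is a square and disappears.\<close>
    have H: "?H (x(A i := s)) (?F (x(A i := s))) =
      (N (x(A i := 0)) ((?F x)(A i := 0)) + (- 1) ^ s * N (x(A i := 1)) ((?F x)(A i := 0))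
     + (- 1) ^ s * N (x(A i := 0)) ((?F x)(A i := 1))
     + N (x(A i := 1)) ((?F x)(A i := 1))) / 2" if "s < 2" for s
      using basis[OF that] assms that
      by (simp add: apply_hadamard_gate F power_add flip: power_mult_distrib)
    have bits: "(0::nat) < 2" "(1::nat) < 2" by simp_all
    \<comment> \<open>Summed over the two values of \<open>s\<close>, the weight
      \<open>(- 1) ^ s\<close> retains the two off-diagonal terms (\<open>i\<close> in
      \<open>T\<close>), and the weight 1 retains the two diagonal ones.\<close>
    show ?thesis
      unfolding H[OF bits(1)] H[OF bits(2)] pK p G
      by (cases "i \<in> T") (simp_all add: field_simps)
  qed
  show ?thesis
    unfolding pauli_expectation_def
    by (subst (1 2) sum_split_ancilla[OF assms(2)]) (auto intro!: sum.cong simp only: split)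
qed

lemma pauli_expectation_hadamard_layer:
  assumes "T \<subseteq> {1..n}" "distinct is" "set is \<subseteq> {1..n}" "set is \<subseteq> K"
  shows "pauli_expectation n d T K
      (fold (apply_gate (regs n) (reg_dim d)) (map (hadamard_gate n) is) N)
    = pauli_expectation n d T (K - set is) N"
  using assms
proof (induction "is" arbitrary: N)
  case Nil
  then show ?case by simp
next
  case (Cons i js)
  \<comment> \<open>\<open>fold\<close> applies the head gate first, so it is innermost: the
    induction hypothesis strips the other gates before it.\<close>
  have "pauli_expectation n d T K
      (fold (apply_gate (regs n) (reg_dim d)) (map (hadamard_gate n) (i # js)) N)
    = pauli_expectation n d T (K - set js)
      (apply_gate (regs n) (reg_dim d) (hadamard_gate n i) N)"
    using Cons by simp
  also have "\<dots> = pauli_expectation n d T (K - set js - {i}) N"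
    using Cons.prems by (intro pauli_expectation_hadamard) auto
  also have "K - set js - {i} = K - set (i # js)"
    by auto
  finally show ?case .
qed

subsection \<open>Controlled swaps\<close>

abbreviation cswap_gate :: "nat \<Rightarrow> nat \<Rightarrow> reg operator" where
  "cswap_gate n i \<equiv> op_on (regs n) {A i, B i, C i} (cswap i)"

lemma cswap_basis_in_basis:
  "x \<in> reg_basis n d \<Longrightarrow> i \<in> {1..n} \<Longrightarrow> cswap_basis i x \<in> reg_basis n d"
  by (auto simp: in_reg_basis cswap_basis_def)

text \<open>A controlled swap is an involution on basis vectors, so the roles of \<open>x\<close>
  and \<open>y\<close> in \<open>cswap\<close> can be exchanged; each row then has a single known
  nonzero column.\<close>

lemma cswap_gate_entry:
  assumes "x \<in> reg_basis n d" "y \<in> reg_basis n d" "i \<in> {1..n}"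
  shows "cswap_gate n i x y = (if y = cswap_basis i x then 1 else 0)"
proof -
  let ?S = "{A i, B i, C i}"
  have "(\<forall>r\<in>regs n - ?S. x r = y r) \<and> restrict x ?S = cswap_basis i (restrict y ?S)
      \<longleftrightarrow> y = cswap_basis i x" (is "?lhs \<longleftrightarrow> _")
  proof
    assume l: ?lhs
    have ABC: "x r = cswap_basis i (restrict y ?S) r" if "r \<in> ?S" for r
      using l that by (metis restrict_apply')
    show "y = cswap_basis i x"
    proof (rule basis_eqI[OF assms(2) cswap_basis_in_basis[OF assms(1,3)]])
      fix r assume "r \<in> regs n"
      then show "y r = cswap_basis i x r"
        using l ABC[of "A i"] ABC[of "B i"] ABC[of "C i"]
        by (cases "r \<in> ?S") (auto simp: cswap_basis_def split: if_splits)
    qed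
  next
    assume "y = cswap_basis i x"
    then show ?lhs
      by (auto simp: cswap_basis_def fun_eq_iff)
  qed
  moreover have "cswap_gate n i x y =
    (if (\<forall>r\<in>regs n - ?S. x r = y r) \<and> restrict x ?S = cswap_basis i (restrict y ?S) then 1 else 0)"
    by (simp add: op_on_def cswap_def)
  ultimately show ?thesis by presburger
qed

lemma apply_cswap_gate:
  assumes "x \<in> reg_basis n d" "y \<in> reg_basis n d" "i \<in> {1..n}"
  shows "apply_gate (regs n) (reg_dim d) (cswap_gate n i) N x y
    = N (cswap_basis i x) (cswap_basis i y)"
proof -
  have "apply_gate (regs n) (reg_dim d) (cswap_gate n i) N x y =
    (\<Sum>w\<in>reg_basis n d. (\<Sum>v\<in>reg_basis n d. if v = cswap_basis i x then N v w else 0)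
       * (if w = cswap_basis i y then 1 else 0))"
    using assms unfolding apply_gate_entry
    by (intro sum.cong refl arg_cong2[where f = "(*)"]) (auto simp: cswap_gate_entry)
  then show ?thesis
    using assms by (simp add: cswap_basis_in_basis if_distrib cong: if_cong)
qed

text \<open>Closed form of the composed controlled swaps with indices in \<open>S\<close>; they act
  on disjoint registers, so no order has to be recorded.\<close>

definition cswap_all :: "nat set \<Rightarrow> (reg \<Rightarrow> nat) \<Rightarrow> reg \<Rightarrow> nat" where
  "cswap_all S x = (\<lambda>r. case r of A i \<Rightarrow> x (A i)
     | B i \<Rightarrow> if i \<in> S \<and> x (A i) = 1 then x (C i) else x (B i)
     | C i \<Rightarrow> if i \<in> S \<and> x (A i) = 1 then x (B i) else x (C i))"

lemma cswap_all_simps [simp]: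
  "cswap_all S x (A i) = x (A i)"
  "cswap_all S x (B i) = (if i \<in> S \<and> x (A i) = 1 then x (C i) else x (B i))"
  "cswap_all S x (C i) = (if i \<in> S \<and> x (A i) = 1 then x (B i) else x (C i))"
  by (simp_all add: cswap_all_def)

lemma cswap_all_in_basis: "x \<in> reg_basis n d \<Longrightarrow> cswap_all S x \<in> reg_basis n d"
  by (auto simp: in_reg_basis)

lemma cswap_all_involution: "cswap_all S (cswap_all S x) = x"
  by (rule reg_fun_eqI) auto

lemma cswap_layer_entry:
  assumes "distinct is" "set is \<subseteq> {1..n}" "x \<in> reg_basis n d" "y \<in> reg_basis n d"
  shows "fold (apply_gate (regs n) (reg_dim d)) (map (cswap_gate n) is) N x y
    = N (cswap_all (set is) x) (cswap_all (set is) y)"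
  using assms
proof (induction "is" arbitrary: N)
  case Nil
  have "cswap_all {} z = z" for z by (rule reg_fun_eqI) auto
  then show ?case by simp
next
  case (Cons i js)
  \<comment> \<open>Distinctness matters here: the swaps for \<open>js\<close> leave the registers
    with index \<open>i\<close> untouched, and \<open>i\<close> is swapped only once.\<close>
  have "cswap_basis i (cswap_all (set js) z) = cswap_all (set (i # js)) z" for z
    using Cons.prems(1) by (intro reg_fun_eqI) (auto simp: cswap_basis_def)
  then show ?case
    using Cons by (simp add: apply_cswap_gate cswap_all_in_basis)
qed

subsection \<open>The weighted sum of the outcome probabilities\<close>

lemma ancilla_proj_gate_entry:
  assumes "x \<in> reg_basis n d" "y \<in> reg_basis n d"
  shows "op_on (regs n) (A ` {1..n}) (ancilla_proj n z) x y =
    (if y = x then if \<forall>i\<in>{1..n}. x (A i) = z i then 1 else 0 else 0)"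
proof -
  have "y = x" if "\<forall>r\<in>regs n - A ` {1..n}. x r = y r" "\<forall>i\<in>{1..n}. x (A i) = z i \<and> y (A i) = z i"
  proof (rule basis_eqI[OF assms(2,1)])
    fix r assume "r \<in> regs n"
    then show "y r = x r" using that by (cases "r \<in> A ` {1..n}") auto
  qed
  then show ?thesis by (auto simp: op_on_def ancilla_proj_def)
qed

lemma sum_swap_test_prob:
  assumes "t \<in> bit_vectors n" "supp n t = T"
  shows "(\<Sum>z\<in>bit_vectors n. (- 1) ^ bit_dot n z t * swap_test_prob n d \<rho> \<sigma> z)
    = Re (pauli_expectation n d T {1..n} (swap_test_output n d \<rho> \<sigma>))"
proof -
  let ?N = "swap_test_output n d \<rho> \<sigma>"
  let ?z = "\<lambda>x. \<lambda>i\<in>{1..n}. x (A i)"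
  have T: "T \<subseteq> {1..n}" using assms(2) by (auto simp: supp_def)
  then have "finite T" using finite_subset by blast
  have t: "t i = (if i \<in> T then 1 else 0)" if "i \<in> {1..n}" for i
  proof -
    have "t i < 2" using assms(1) that by (auto simp: basis_def)
    then show ?thesis using assms(2) that by (auto simp: supp_def)
  qed
  have dot: "(- 1) ^ bit_dot n (?z x) t = (\<Prod>i\<in>T. (- 1) ^ x (A i) :: real)" for x
  proof -
    have "bit_dot n (?z x) t = (\<Sum>i\<in>{1..n}. if i \<in> T then x (A i) else 0)"
      unfolding bit_dot_def by (intro sum.cong) (auto simp: t)
    also have "\<dots> = (\<Sum>i\<in>T. x (A i))"
      using T by (simp add: sum.If_cases Int_absorb1)
    finally show ?thesis by (simp add: power_sum)
  qed
  \<comment> \<open>The projector is diagonal, so the Born rule collects the diagonal entries whose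
    ancilla part is \<open>z\<close>.\<close>
  have prob: "swap_test_prob n d \<rho> \<sigma> z
      = (\<Sum>x\<in>reg_basis n d. if z = ?z x then Re (?N x x) else 0)"
    if z: "z \<in> bit_vectors n" for z
  proof -
    have "op_mult (regs n) (reg_dim d) (op_on (regs n) (A ` {1..n}) (ancilla_proj n z)) ?N x x
      = (if z = ?z x then ?N x x else 0)" if x: "x \<in> reg_basis n d" for x
    proof -
      have eq: "(\<forall>i\<in>{1..n}. x (A i) = z i) \<longleftrightarrow> z = ?z x"
      proof
        assume "\<forall>i\<in>{1..n}. x (A i) = z i"
        moreover have "?z x \<in> bit_vectors n"
          using x by (auto simp: basis_def in_reg_basis[unfolded basis_def])
        ultimately show "z = ?z x" using z by (intro basis_eqI) auto
      qed simp
      have "op_mult (regs n) (reg_dim d) (op_on (regs n) (A ` {1..n}) (ancilla_proj n z)) ?N x x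
        = (\<Sum>w\<in>reg_basis n d. if w = x then if z = ?z x then ?N w x else 0 else 0)"
        unfolding op_mult_def
        by (intro sum.cong refl) (simp only: ancilla_proj_gate_entry[OF x] eq, simp)
      then show ?thesis using x by simp
    qed
    then show ?thesis
      unfolding swap_test_prob_def op_trace_def by (auto intro!: sum.cong)
  qed
  have "(\<Sum>z\<in>bit_vectors n. (- 1) ^ bit_dot n z t * swap_test_prob n d \<rho> \<sigma> z)
     = (\<Sum>z\<in>bit_vectors n. \<Sum>x\<in>reg_basis n d.
         if z = ?z x then (- 1) ^ bit_dot n z t * Re (?N x x) else 0)"
    by (intro sum.cong refl) (auto simp: prob sum_distrib_left intro!: sum.cong)
  also have "\<dots> = (\<Sum>x\<in>reg_basis n d. \<Sum>z\<in>bit_vectors n.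
         if z = ?z x then (- 1) ^ bit_dot n z t * Re (?N x x) else 0)"
    by (rule sum.swap)
  \<comment> \<open>Each basis vector contributes to exactly one outcome, namely its own ancilla
    part.\<close>
  also have "\<dots> = (\<Sum>x\<in>reg_basis n d. (\<Prod>i\<in>T. (- 1) ^ x (A i)) * Re (?N x x))"
  proof (intro sum.cong refl)
    fix x assume "x \<in> reg_basis n d"
    then have "?z x \<in> bit_vectors n"
      by (auto simp: basis_def in_reg_basis[unfolded basis_def])
    then show "(\<Sum>z\<in>bit_vectors n. if z = ?z x then (- 1) ^ bit_dot n z t * Re (?N x x) else 0)
      = (\<Prod>i\<in>T. (- 1) ^ x (A i)) * Re (?N x x)"
      by (simp add: dot[unfolded One_nat_def])
  qed
  \<comment> \<open>With \<open>K = {1..n}\<close> nothing is flipped, so only diagonal entries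
    occur, and the real signs commute with \<open>Re\<close>.\<close>
  also have "\<dots> = Re (pauli_expectation n d T {1..n} ?N)"
  proof -
    have "(\<Prod>i\<in>T. (- 1) ^ x (A i) :: complex) = of_real (\<Prod>i\<in>T. (- 1) ^ x (A i))" for x :: "reg \<Rightarrow> nat"
      by simp
    moreover have flip: "flip_ancillas {} x = x" for x by (rule reg_fun_eqI) auto
    moreover have TK: "T - {1..n} = {}" "T \<inter> {1..n} = T" using T by auto
    ultimately show ?thesis
      unfolding pauli_expectation_def TK flip by (simp del: of_real_prod)
  qed
  finally show ?thesis .
qed

lemma pauli_expectation_output:
  assumes "T \<subseteq> {1..n}"
  shows "pauli_expectation n d T {1..n} (swap_test_output n d \<rho> \<sigma>) =
    (\<Sum>b\<in>basis {1..n} d. \<Sum>c\<in>basis {1..n} d.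
       \<rho> b (override_on b c T) * \<sigma> c (override_on c b T))"
proof -
  let ?fold = "fold (apply_gate (regs n) (reg_dim d))"
  let ?b = "\<lambda>x. \<lambda>i\<in>{1..n}. x (B i)" and ?c = "\<lambda>x. \<lambda>i\<in>{1..n}. x (C i)"
  let ?S = "cswap_all {1..n}" and ?F = "flip_ancillas T"
  define g where "g x y = \<rho> (?b x) (?b y) * \<sigma> (?c x) (?c y)" for x y
  have set: "set [1..<Suc n] = {1..n}" by auto
  define M where "M = ?fold (hadamard_layer n) (swap_test_input n \<rho> \<sigma>)"
  \<comment> \<open>All ancillas are now in the uniform superposition: the entry does not depend on
    the ancilla bits.\<close>
  have M: "M x y = g x y / 2 ^ n" if "x \<in> reg_basis n d" "y \<in> reg_basis n d" for x y
  proof -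
    have input: "swap_test_input n \<rho> \<sigma> =
      (\<lambda>x y. (\<Prod>i\<in>set [1..<Suc n]. if x (A i) = 0 \<and> y (A i) = 0 then 1 else 0) * g x y)"
      unfolding set by (simp add: swap_test_input_def g_def mult.assoc fun_eq_iff)
    show ?thesis
      unfolding M_def hadamard_layer_def input
      by (subst hadamard_layer_on_zeros) (use that in \<open>auto simp: g_def simp del: upt_Suc\<close>)
  qed
  \<comment> \<open>The last Hadamard layer empties \<open>K\<close>: every Z on \<open>T\<close>
    has become an X.\<close>
  have "pauli_expectation n d T {1..n} (swap_test_output n d \<rho> \<sigma>)
    = pauli_expectation n d T {} (?fold (cswap_layer n) M)"
    using pauli_expectation_hadamard_layer[OF assms, of "[1..<Suc n]" "{1..n}" d
        "?fold (cswap_layer n) M"]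
    unfolding swap_test_output_def M_def hadamard_layer_def set by (simp del: upt_Suc)
  also have "\<dots> = (\<Sum>x\<in>reg_basis n d. g (?S x) (?S (?F x)) / 2 ^ n)"
  proof -
    have "?fold (cswap_layer n) M x (?F x) = g (?S x) (?S (?F x)) / 2 ^ n"
      if "x \<in> reg_basis n d" for x
      unfolding cswap_layer_def
      by (subst cswap_layer_entry)
        (use that assms in \<open>auto simp: flip_ancillas_in_basis cswap_all_in_basis M
          atLeastLessThanSuc_atLeastAtMost simp del: upt_Suc\<close>)
    then show ?thesis by (simp add: pauli_expectation_def)
  qed
  \<comment> \<open>Relabelling by the involution \<open>?S\<close> frees the first index of swaps;
    both swap layers now act on the second index.\<close>
  also have "\<dots> = (\<Sum>x\<in>reg_basis n d. g x (?S (?F (?S x))) / 2 ^ n)"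
    by (intro sum.reindex_bij_witness[of _ ?S ?S])
      (auto simp: cswap_all_involution cswap_all_in_basis)
  also have "\<dots> = (\<Sum>x\<in>reg_basis n d.
      \<rho> (?b x) (override_on (?b x) (?c x) T) * \<sigma> (?c x) (override_on (?c x) (?b x) T) / 2 ^ n)"
  proof (intro sum.cong refl)
    fix x assume x: "x \<in> reg_basis n d"
    have bit: "Suc 0 - x (A i) = Suc 0 \<longleftrightarrow> x (A i) \<noteq> Suc 0" if "i \<in> {1..n}" for i
    proof -
      have "x (A i) < 2" using x that by (auto simp: in_reg_basis)
      then show ?thesis by linarith
    qed
    \<comment> \<open>On \<open>T\<close> the control bit is flipped between the two swap layers, so
      exactly one of them exchanges B and C. Off \<open>T\<close> both or neither do, and nothing
      changes.\<close>
    have "?b (?S (?F (?S x))) = override_on (?b x) (?c x) T"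
      using assms by (auto simp: fun_eq_iff override_on_def bit)
    moreover have "?c (?S (?F (?S x))) = override_on (?c x) (?b x) T"
      using assms by (auto simp: fun_eq_iff override_on_def bit)
    ultimately show "g x (?S (?F (?S x))) / 2 ^ n = \<rho> (?b x) (override_on (?b x) (?c x) T)
        * \<sigma> (?c x) (override_on (?c x) (?b x) T) / 2 ^ n"
      by (simp add: g_def)
  qed
  \<comment> \<open>The summand no longer mentions the ancilla bits. Once they are split off, their
    \<open>2 ^ n\<close> values cancel the normalisation.\<close>
  also have "\<dots> = (\<Sum>(a, b, c)\<in>bit_vectors n \<times> basis {1..n} d \<times> basis {1..n} d.
      \<rho> b (override_on b c T) * \<sigma> c (override_on c b T) / 2 ^ n)"
    by (rule sum.reindex_bij_witness[of _
          "\<lambda>(a, b, c) r. case r of A i \<Rightarrow> a i | B i \<Rightarrow> b i | C i \<Rightarrow> c i"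
          "\<lambda>x. (\<lambda>i\<in>{1..n}. x (A i), ?b x, ?c x)"])
      (auto simp: in_reg_basis, auto simp: basis_def in_reg_basis[unfolded basis_def] PiE_iff
        extensional_def fun_eq_iff split: reg.splits)
  also have "\<dots> = (\<Sum>b\<in>basis {1..n} d. \<Sum>c\<in>basis {1..n} d.
       \<rho> b (override_on b c T) * \<sigma> c (override_on c b T))"
  proof -
    have "card (bit_vectors n) = 2 ^ n"
      by (simp add: basis_def card_PiE)
    then show ?thesis
      by (simp add: sum.cartesian_product[symmetric] flip: sum_divide_distrib)
  qed
  finally show ?thesis .
qed

subsection \<open>The overlap of the reduced states\<close>

lemma override_on_in_basis:
  assumes "S \<subseteq> R" "w \<in> basis (R - S) d" "x \<in> basis S d"
  shows "override_on w x S \<in> basis R d"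
  using assms by (auto simp: basis_def PiE_iff extensional_def override_on_def)

lemma sum_basis_split:
  assumes "S \<subseteq> R"
  shows "(\<Sum>b\<in>basis R d. f b) = (\<Sum>x\<in>basis S d. \<Sum>u\<in>basis (R - S) d. f (override_on u x S))"
proof -
  have "(\<Sum>b\<in>basis R d. f b) = (\<Sum>(x, u)\<in>basis S d \<times> basis (R - S) d. f (override_on u x S))"
    using assms
    by (intro sum.reindex_bij_witness[of _ "\<lambda>(x, u). override_on u x S"
          "\<lambda>b. (restrict b S, restrict b (R - S))"])
      (auto simp: basis_def PiE_iff extensional_def override_on_def fun_eq_iff
        intro!: arg_cong[where f = f])
  then show ?thesis by (simp add: sum.cartesian_product)
qed

text \<open>The swap trick: \<open>override_on b c S\<close> and \<open>override_on c b S\<close>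
  exchange the \<open>S\<close>-parts of \<open>b\<close> and \<open>c\<close>. The parts outside
  \<open>S\<close> agree in both indices of each factor, so summing over them is the partial
  trace.\<close>

lemma trace_reduced_product:
  assumes "S \<subseteq> R"
  shows "op_trace S d (op_mult S d (reduced R d S \<rho>) (reduced R d S \<sigma>)) =
    (\<Sum>b\<in>basis R d. \<Sum>c\<in>basis R d. \<rho> b (override_on b c S) * \<sigma> c (override_on c b S))"
proof -
  have over: "override_on (override_on u x S) (override_on v w S) S = override_on u w S"
    for u v x w :: "'a \<Rightarrow> nat"
    by (auto simp: override_on_def)
  have "(\<Sum>b\<in>basis R d. \<Sum>c\<in>basis R d. \<rho> b (override_on b c S) * \<sigma> c (override_on c b S)) =
    (\<Sum>x\<in>basis S d. \<Sum>u\<in>basis (R - S) d. \<Sum>w\<in>basis S d. \<Sum>v\<in>basis (R - S) d.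
      \<rho> (override_on u x S) (override_on u w S) * \<sigma> (override_on v w S) (override_on v x S))"
    by (simp add: sum_basis_split[OF assms] over)
  also have "\<dots> = (\<Sum>x\<in>basis S d. \<Sum>w\<in>basis S d. \<Sum>u\<in>basis (R - S) d. \<Sum>v\<in>basis (R - S) d.
      \<rho> (override_on u x S) (override_on u w S) * \<sigma> (override_on v w S) (override_on v x S))"
    by (intro sum.cong refl sum.swap)
  finally show ?thesis
    by (simp add: op_trace_def op_mult_def reduced_def sum_product)
qed

lemma reduced_hermitian:
  assumes "finite R" "S \<subseteq> R" "pos_semidef R d M" "x \<in> basis S d" "y \<in> basis S d"
  shows "cnj (reduced R d S M x y) = reduced R d S M y x"
  using assms
  by (auto simp: reduced_def override_on_in_basis pos_semidef_hermitian intro!: sum.cong)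

text \<open>Conjugation transposes both Hermitian factors, and renaming the two summation indices
  undoes this. Realness is wanted because outcome probabilities are defined through
  \<open>Re\<close>.\<close>

lemma trace_reduced_product_real:
  assumes "finite R" "S \<subseteq> R" "pos_semidef R d \<rho>" "pos_semidef R d \<sigma>"
  shows "op_trace S d (op_mult S d (reduced R d S \<rho>) (reduced R d S \<sigma>)) \<in> \<real>"
proof -
  let ?r = "reduced R d S \<rho>" and ?s = "reduced R d S \<sigma>"
  have "cnj (op_trace S d (op_mult S d ?r ?s)) =
    (\<Sum>x\<in>basis S d. \<Sum>w\<in>basis S d. ?r w x * ?s x w)"
    unfolding op_trace_def op_mult_def
    using assms by (auto simp: reduced_hermitian intro!: sum.cong)
  also have "\<dots> = op_trace S d (op_mult S d ?r ?s)"
    unfolding op_trace_def op_mult_def by (rule sum.swap)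
  finally show ?thesis by (simp add: Reals_cnj_iff)
qed

theorem proposition7:
  fixes n :: nat and d :: "nat \<Rightarrow> nat" and \<rho> \<sigma> :: "nat operator"
    and T :: "nat set" and t :: "nat \<Rightarrow> nat"
  assumes "state {1..n} d \<rho>"
    and "state {1..n} d \<sigma>"
    and "T \<subseteq> {1..n}"
    and "t \<in> bit_vectors n"
    and "supp n t = T"
  shows "op_trace T d (op_mult T d (reduced {1..n} d T \<rho>) (reduced {1..n} d T \<sigma>)) =
    complex_of_real (\<Sum>z\<in>bit_vectors n. (- 1) ^ bit_dot n z t * swap_test_prob n d \<rho> \<sigma> z)"
  unfolding sum_swap_test_prob[OF assms(4,5)] pauli_expectation_output[OF assms(3)]
    trace_reduced_product[OF assms(3), symmetric]
  \<comment> \<open>The right side has become the real part of the left side, so it remains to see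
    that the overlap is real.\<close>
  using trace_reduced_product_real[of "{1..n}" T d \<rho> \<sigma>] assms
  by (simp add: state_def)

end
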